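(* For positive integers $k,R,S$ with $k\ge 1$ and $1\le S<R$, and for every integer $n\ge 1$, the coefficient of $q^n$ in $$(-1)^{k-1}\Bigg(\frac{\sum_{j=-k}^{k-1}(-1)^j\,j\,q^{Rj(j+1)/2-Sj}}{(q^S,q^{R-S},q^R;q^R)_{\infty}}-\sum_{m=0}^{\infty}\Big(\frac{q^{mR+S}}{1-q^{mR+S}}-\frac{q^{mR+R-S}}{1-q^{mR+R-S}} \Big) \Bigg)$$ is nonnegative.
   Context: Assume $|q|<1$; the expression is expanded as a power series in $q$. The notation is $$(x_1,x_2,\dots,x_r;q)_{\infty}=\prod_{i=0}^{\infty}(1-x_1q^i)(1-x_2q^i)\cdots(1-x_rq^i),$$ so that $$(q^S,q^{R-S},q^R;q^R)_\infty=\prod_{i=0}^\infty (1-q^{Ri+S})(1-q^{Ri+R-S})(1-q^{Ri+R}).$$ *)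

theory Defs
  imports "HOL-Analysis.Analysis"
begin

text \<open>
  Identities in a variable \<open>q\<close> with \<open>|q| < 1\<close>, expanded as power series in \<open>q\<close>, are rendered in
  the ring of formal power series over the reals, with \<open>q\<close> being \<^const>\<open>fps_X\<close>. Infinite sums and
  products are limits in the \<open>q\<close>-adic metric, the library's metric on \<^typ>\<open>real fps\<close>; they do
  converge, by \<open>has_prod_qpoch_inf\<close> and \<open>summable_lambert\<close> below.
\<close>

definition qpoch_inf :: "'a::{t2_space, comm_ring_1} list \<Rightarrow> 'a \<Rightarrow> 'a" where
  "qpoch_inf xs q = (\<Prod>i. \<Prod>x\<leftarrow>xs. (1 - x * q ^ i))"

text \<open>
  For \<open>1 \<le> S < R\<close> the exponent \<open>R j (j + 1) / 2 - S j\<close> is a nonnegative integer for every integer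
  \<open>j\<close>, so neither the integer division nor the conversion to \<^typ>\<open>nat\<close> loses information.
\<close>

definition theta_exponent :: "nat \<Rightarrow> nat \<Rightarrow> int \<Rightarrow> nat" where
  "theta_exponent R S j = nat (int R * j * (j + 1) div 2 - int S * j)"

lemma real_theta_exponent:
  assumes "S < R"
  shows "real (theta_exponent R S j) = real R * of_int j * (of_int j + 1) / 2 - real S * of_int j"
proof -
  have ev: "even (int R * j * (j + 1))" by simp
  have "int S * j * 2 \<le> int R * j * (j + 1)"
  proof (cases "j \<ge> 0")
    case True
    show ?thesis
    proof (cases "j = 0")
      case False
      with True have "j \<ge> 1" by simp
      then have "int R * 2 \<le> int R * (j + 1)" by (intro mult_left_mono) auto
      with assms have "int S * 2 \<le> int R * (j + 1)" by linarith
      with True have "j * (int S * 2) \<le> j * (int R * (j + 1))" by (intro mult_left_mono)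
      then show ?thesis by (simp add: algebra_simps)
    qed simp
  next
    case False
    then have "int S * j \<le> 0" by (intro mult_nonneg_nonpos) auto
    then have "int S * j * 2 \<le> 0" by linarith
    also have "0 \<le> int R * (j * (j + 1))"
      using False by (intro mult_nonneg_nonneg mult_nonpos_nonpos) auto
    finally show ?thesis by (simp only: mult.assoc)
  qed
  then have nonneg: "int R * j * (j + 1) div 2 - int S * j \<ge> 0" by linarith
  have "real (theta_exponent R S j) = of_int (int R * j * (j + 1) div 2 - int S * j)"
    unfolding theta_exponent_def using nonneg by simp
  also have "\<dots> = of_int (int R * j * (j + 1)) / 2 - of_int (int S * j)"
    using real_of_int_div[of 2 "int R * j * (j + 1)"] ev by simp
  finally show ?thesis by simp
qed

lemma fps_nth_eqI_dvd:
  fixes f g :: "real fps"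
  assumes "fps_X ^ m dvd f - g" "n < m"
  shows "fps_nth f n = fps_nth g n"
proof -
  from assms(1) obtain h where "f - g = fps_X ^ m * h" by (auto simp: dvd_def)
  then have "fps_nth (f - g) n = 0" using assms(2) by (simp add: fps_X_power_mult_nth)
  then show ?thesis by simp
qed

lemma fps_partial_sums_LIMSEQ:
  fixes s :: "nat \<Rightarrow> real fps"
  assumes "\<And>i. fps_X ^ i dvd s (Suc i) - s i"
  shows "\<exists>p. s \<longlonglongrightarrow> p \<and> (\<forall>n. fps_nth p n = fps_nth (s (Suc n)) n)"
proof -
  have stable: "fps_nth (s m) n = fps_nth (s (Suc n)) n" if "m \<ge> Suc n" for m n
    using that
  proof (induction m rule: dec_induct)
    case (step m)
    have "fps_nth (s (Suc m)) n = fps_nth (s m) n"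
      using fps_nth_eqI_dvd[OF assms] step by simp
    with step show ?case by simp
  qed simp
  define p where "p = Abs_fps (\<lambda>n. fps_nth (s (Suc n)) n)"
  have "s \<longlonglongrightarrow> p"
  proof (rule tendsto_fpsI)
    fix n
    show "eventually (\<lambda>m. fps_nth (s m) n = fps_nth p n) sequentially"
      using eventually_ge_at_top[of "Suc n"]
      by eventually_elim (simp only: p_def fps_nth_Abs_fps, rule stable)
  qed
  then show ?thesis by (auto simp: p_def)
qed

lemma has_prod_qpoch_inf:
  assumes "1 \<le> S" "S < R"
  defines "f \<equiv> \<lambda>i. \<Prod>x\<leftarrow>[fps_X ^ S, fps_X ^ (R - S), fps_X ^ R]. (1 - x * (fps_X ^ R) ^ i :: real fps)"
  shows "f has_prod qpoch_inf [fps_X ^ S, fps_X ^ (R - S), fps_X ^ R] (fps_X ^ R)"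
    and "fps_nth (qpoch_inf [fps_X ^ S, fps_X ^ (R - S), fps_X ^ R] (fps_X ^ R :: real fps)) 0 = 1"
proof -
  have f_eq: "\<exists>h. f i = 1 - fps_X ^ Suc i * h" for i
  proof -
    have le: "Suc i \<le> S + R * i" "Suc i \<le> R - S + R * i" "Suc i \<le> R + R * i"
      using assms(1,2) mult_le_mono1[of 1 R i] by linarith+
    obtain a b c where abc: "S + R * i = Suc i + a" "R - S + R * i = Suc i + b"
      "R + R * i = Suc i + c"
      using le_Suc_ex[OF le(1)] le_Suc_ex[OF le(2)] le_Suc_ex[OF le(3)] by blast
    define X where "X = (fps_X ^ Suc i :: real fps)"
    have x: "fps_X ^ S * (fps_X ^ R) ^ i = X * fps_X ^ a"
      "fps_X ^ (R - S) * (fps_X ^ R) ^ i = X * fps_X ^ b"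
      "fps_X ^ R * (fps_X ^ R) ^ i = X * fps_X ^ c"
      unfolding X_def power_mult[symmetric] power_add[symmetric] abc by simp_all
    have "f i = (1 - X * fps_X ^ a) * ((1 - X * fps_X ^ b) * (1 - X * fps_X ^ c))"
      by (simp only: f_def list.map prod_list.Cons prod_list.Nil mult_1_right x)
    also have "\<dots> = 1 - X * (fps_X ^ a + (1 - X * fps_X ^ a) * (fps_X ^ b + (1 - X * fps_X ^ b) * fps_X ^ c))"
      by (simp add: algebra_simps)
    finally show ?thesis unfolding X_def by blast
  qed
  define s where "s = (\<lambda>n. \<Prod>i\<le>n. f i)"
  have step: "fps_X ^ i dvd s (Suc i) - s i" for i
  proof -
    obtain h where h: "f (Suc i) = 1 - fps_X ^ Suc (Suc i) * h" using f_eq by blast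
    have "s (Suc i) - s i = fps_X ^ i * (- s i * fps_X ^ 2 * h)"
      by (simp add: s_def h algebra_simps power2_eq_square)
    then show ?thesis by (rule dvdI)
  qed
  obtain p where p: "s \<longlonglongrightarrow> p" "\<And>n. fps_nth p n = fps_nth (s (Suc n)) n"
    using fps_partial_sums_LIMSEQ[of s] step by blast
  have f0: "fps_nth (f i) 0 = 1" for i
    using f_eq[of i] by auto
  have p0: "fps_nth p 0 = 1" using p(2)[of 0] f0 by (simp add: s_def)
  then have "p \<noteq> 0" by auto
  with p(1) have "f has_prod p" by (simp add: has_prod_def raw_has_prod_def s_def)
  moreover from this have "qpoch_inf [fps_X ^ S, fps_X ^ (R - S), fps_X ^ R] (fps_X ^ R) = p"
    unfolding qpoch_inf_def f_def by (rule has_prod_unique[symmetric])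
  ultimately show "f has_prod qpoch_inf [fps_X ^ S, fps_X ^ (R - S), fps_X ^ R] (fps_X ^ R)"
    and "fps_nth (qpoch_inf [fps_X ^ S, fps_X ^ (R - S), fps_X ^ R] (fps_X ^ R :: real fps)) 0 = 1"
    using p0 by simp_all
qed

lemma summable_lambert:
  assumes "1 \<le> S" "S < R"
  shows "summable (\<lambda>m. fps_X ^ (m * R + S) / (1 - fps_X ^ (m * R + S))
      - fps_X ^ (m * R + R - S) / (1 - fps_X ^ (m * R + R - S)) :: real fps)"
proof -
  define L where "L = (\<lambda>a. fps_X ^ a / (1 - fps_X ^ a) :: real fps)"
  define g where "g = (\<lambda>m. L (m * R + S) - L (m * R + R - S))"
  have dvd: "fps_X ^ i dvd L a" if "i \<le> a" "0 < a" for i a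
    using that unfolding L_def
    by (subst fps_divide_unit) (auto intro!: dvd_mult2 le_imp_power_dvd)
  have "fps_X ^ i dvd g i" for i
  proof -
    have "i \<le> i * R + S" "i \<le> i * R + R - S" "0 < i * R + S" "0 < i * R + R - S"
      using assms mult_le_mono2[of 1 R i] by linarith+
    then show ?thesis unfolding g_def by (intro dvd_diff dvd)
  qed
  then have "fps_X ^ i dvd (\<Sum>m<Suc i. g m) - (\<Sum>m<i. g m)" for i by simp
  then obtain p where "(\<lambda>n. \<Sum>m<n. g m) \<longlonglongrightarrow> p"
    using fps_partial_sums_LIMSEQ[of "\<lambda>n. \<Sum>m<n. g m"] by blast
  then show ?thesis unfolding g_def L_def summable_def sums_def by blast
qed

end

theory Submission
  imports Defs
begin

text \<open>
  Put \<open>w = q^(R-S)\<close>, \<open>x = q^S\<close>, \<open>Q = q^R\<close>. The normalised product of the factors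
  \<open>(1 + z w Q^i)(1 + x Q^i / z) / ((1 - w Q^i)(1 - x Q^i))\<close> over \<open>i < N\<close> is a product of
  \<open>1 + u (1 + z)\<close> and \<open>1 + v (1 + 1/z)\<close>, where \<open>u = w Q^i / (1 - w Q^i)\<close> and
  \<open>v = x Q^i / (1 - x Q^i)\<close> have nonnegative coefficients. Let \<open>f j\<close> be its coefficient of \<open>z^j\<close>.
  At \<open>z = -1\<close> the product is 1, and its logarithmic derivative makes
  \<open>\<Sum>j. (-1)^j j (f j)\<close> the partial Lambert series \<open>\<Sum>(v - u)\<close>. Hence the truncation error is, up to
  sign, the sum of the two alternating tails \<open>\<Sum>j\<ge>k\<close> and \<open>\<Sum>j<-k\<close> of \<open>j (f j)\<close>; that these are nonnegative,
  together with the tails of \<open>f j\<close> itself, is preserved by every single factor,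
  whatever the nonnegative \<open>u\<close> and \<open>v\<close> are. By the finite form of the Jacobi triple product,
  \<open>f j\<close> tends to the theta term over the infinite product as \<open>N\<close> grows.
\<close>

section \<open>Power series with nonnegative coefficients\<close>

definition fps_nonneg :: "real fps \<Rightarrow> bool" where
  "fps_nonneg f \<longleftrightarrow> (\<forall>n. 0 \<le> fps_nth f n)"

lemma fps_nonneg_0 [simp]: "fps_nonneg 0"
  and fps_nonneg_1 [simp]: "fps_nonneg 1"
  by (simp_all add: fps_nonneg_def)

lemma fps_nonneg_add: "fps_nonneg f \<Longrightarrow> fps_nonneg g \<Longrightarrow> fps_nonneg (f + g)"
  by (simp add: fps_nonneg_def)

lemma fps_nonneg_mult: "fps_nonneg f \<Longrightarrow> fps_nonneg g \<Longrightarrow> fps_nonneg (f * g)"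
  by (auto simp: fps_nonneg_def fps_mult_nth intro!: sum_nonneg)

lemma fps_nonneg_of_int: "0 \<le> k \<Longrightarrow> fps_nonneg (of_int k)"
  by (auto simp: fps_nonneg_def fps_of_int[symmetric])

text \<open>The geometric series solves \<open>g = 1 + fps_X ^ a * g\<close>, which reduces
  coefficient \<open>m\<close> to coefficient \<open>m - a\<close>.\<close>

lemma fps_nonneg_geometric:
  assumes "0 < a"
  shows "fps_nonneg (fps_X ^ a * inverse (1 - fps_X ^ a))"
proof -
  have "fps_nth (inverse (1 - fps_X ^ a) :: real fps) m \<ge> 0" for m
  proof (induction m rule: less_induct)
    case (less m)
    define g where "g = (inverse (1 - fps_X ^ a) :: real fps)"
    have "(1 - fps_X ^ a) * g = 1"
      unfolding g_def using assms by (intro inverse_mult_eq_1') auto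
    then have "g = 1 + fps_X ^ a * g" by (simp add: algebra_simps)
    then have "fps_nth g m = fps_nth (1 + fps_X ^ a * g) m" by simp
    also have "\<dots> = of_bool (m = 0) + (if m < a then 0 else fps_nth g (m - a))"
      by (simp add: fps_X_power_mult_nth)
    also have "\<dots> \<ge> 0" using less[of "m - a"] assms by (auto simp: g_def)
    finally show ?case by (simp add: g_def)
  qed
  moreover have "fps_nonneg (fps_X ^ a)" by (simp add: fps_nonneg_def fps_X_power_nth)
  ultimately show ?thesis by (intro fps_nonneg_mult) (auto simp: fps_nonneg_def)
qed

section \<open>Alternating tails of Laurent polynomials\<close>

definition sgn_parity :: "int \<Rightarrow> 'a::ring_1" where
  "sgn_parity k = (if even k then 1 else -1)"

lemma sgn_parity_shift [simp]:
  "sgn_parity (k + 1) = - sgn_parity k" "sgn_parity (k - 1) = - sgn_parity k"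
  "sgn_parity (- k) = sgn_parity k" "sgn_parity (1 + k) = - sgn_parity k"
  "sgn_parity (- k - 1) = - sgn_parity k" "sgn_parity (- 1 - k) = - sgn_parity k"
  by (auto simp: sgn_parity_def)

text \<open>
  Here \<open>A k = (\<Sum>j\<ge>k. (-1)^(j-k) f j)\<close> and \<open>G k = (\<Sum>j\<ge>k. (-1)^(j-k) j f j)\<close> for a finitely
  supported \<open>f\<close>, encoded by their recurrences; the alternating sums of \<open>f j\<close> and \<open>j f j\<close> over all
  integers are \<open>1\<close> and \<open>L\<close>, so that \<open>A (-k) - (-1)^k\<close> and \<open>(-1)^k L - G (-k)\<close> are tails towards
  minus infinity.
\<close>

definition nonneg_alternating_tails ::
    "(int \<Rightarrow> real fps) \<Rightarrow> (int \<Rightarrow> real fps) \<Rightarrow> (int \<Rightarrow> real fps) \<Rightarrow> real fps \<Rightarrow> bool" where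
  "nonneg_alternating_tails f A G L \<longleftrightarrow>
     (\<forall>j. fps_nonneg (f j)) \<and>
     (\<forall>k. A k + A (k + 1) = f k) \<and>
     (\<forall>k. G k + G (k + 1) = of_int k * f k) \<and>
     (\<forall>k\<ge>0. fps_nonneg (A k)) \<and>
     (\<forall>k\<ge>0. fps_nonneg (A (- k) - sgn_parity k)) \<and>
     (\<forall>k\<ge>1. fps_nonneg (G k)) \<and>
     (\<forall>k\<ge>1. fps_nonneg (sgn_parity k * L - G (- k)))"

text \<open>This is the empty product. A tail starting at \<open>k \<le> 0\<close> meets only the
  index 0, with sign \<open>(-1)^k\<close>, so the tails towards minus infinity vanish.\<close>

lemma nonneg_alternating_tails_base:
  "nonneg_alternating_tails (\<lambda>j. of_bool (j = 0)) (\<lambda>k. if k \<le> 0 then sgn_parity k else 0) (\<lambda>_. 0) 0"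
  by (auto simp: nonneg_alternating_tails_def sgn_parity_def)
    presburger

text \<open>
  The next two lemmas multiply the Laurent polynomial with coefficients \<open>f j\<close> by
  \<open>1 + u (1 + z)\<close> and by \<open>1 + v (1 + 1/z)\<close>.
\<close>

lemma nonneg_alternating_tails_mult_pos:
  assumes f: "nonneg_alternating_tails f A G L" and u: "fps_nonneg u"
  shows "nonneg_alternating_tails (\<lambda>j. f j + u * (f j + f (j - 1)))
    (\<lambda>k. A k + u * f (k - 1))
    (\<lambda>k. G k + u * (of_int (k - 1) * f (k - 1) + A (k - 1))) (L - u)"
proof -
  have *: "\<And>j. fps_nonneg (f j)" "\<And>k. A k + A (k + 1) = f k"
    "\<And>k. G k + G (k + 1) = of_int k * f k"
    "\<And>k. k \<ge> 0 \<Longrightarrow> fps_nonneg (A k)" "\<And>k. k \<ge> 0 \<Longrightarrow> fps_nonneg (A (- k) - sgn_parity k)"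
    "\<And>k. k \<ge> 1 \<Longrightarrow> fps_nonneg (G k)"
    "\<And>k. k \<ge> 1 \<Longrightarrow> fps_nonneg (sgn_parity k * L - G (- k))"
    using f by (auto simp: nonneg_alternating_tails_def)
  have A': "A (k - 1) = f (k - 1) - A k" for k using *(2)[of "k - 1"] by (simp add: algebra_simps)
  have G': "G (k + 1) = of_int k * f k - G k" for k using *(3)[of k] by (simp add: algebra_simps)
  have "fps_nonneg (A (- k) + u * f (- k - 1) - sgn_parity k)" if "k \<ge> 0" for k
  proof -
    have "fps_nonneg ((A (- k) - sgn_parity k) + u * f (- k - 1))"
      using that by (intro fps_nonneg_add fps_nonneg_mult * u)
    then show ?thesis by (simp add: algebra_simps)
  qed
  moreover have "fps_nonneg (sgn_parity k * (L - u)
      - (G (- k) + u * (of_int (- k - 1) * f (- k - 1) + A (- k - 1))))" if "k \<ge> 1" for k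
  proof -
    \<comment> \<open>The recurrence turns \<open>- A (- k - 1)\<close> into
      \<open>A (- k) - f (- k - 1)\<close>, and the change of \<open>L\<close> by \<open>- u\<close>
      supplies the sign that completes the lower tail of \<open>f\<close>.\<close>
    have "fps_nonneg ((sgn_parity k * L - G (- k))
        + u * (of_int k * f (- k - 1) + (A (- k) - sgn_parity k)))"
      using that by (intro fps_nonneg_add fps_nonneg_mult fps_nonneg_of_int * u) auto
    also have "A (- k) = f (- k - 1) - A (- k - 1)" using A'[of "- k"] by simp
    finally show ?thesis by (simp add: algebra_simps)
  qed
  moreover have "fps_nonneg (G k + u * (of_int (k - 1) * f (k - 1) + A (k - 1)))" if "k \<ge> 1" for k
    using that by (intro fps_nonneg_add fps_nonneg_mult fps_nonneg_of_int * u) auto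
  moreover have "fps_nonneg (f j + u * (f j + f (j - 1)))" for j
    by (intro fps_nonneg_add fps_nonneg_mult * u)
  moreover have "fps_nonneg (A k + u * f (k - 1))" if "k \<ge> 0" for k
    using that by (intro fps_nonneg_add fps_nonneg_mult * u)
  moreover have "A k + u * f (k - 1) + (A (k + 1) + u * f (k + 1 - 1)) = f k + u * (f k + f (k - 1))" for k
    by (simp add: *(2)[of k, symmetric] algebra_simps)
  moreover have "G k + u * (of_int (k - 1) * f (k - 1) + A (k - 1))
      + (G (k + 1) + u * (of_int (k + 1 - 1) * f (k + 1 - 1) + A (k + 1 - 1)))
      = of_int k * (f k + u * (f k + f (k - 1)))" for k
    unfolding A'[of k] G' by (simp add: algebra_simps)
  ultimately show ?thesis unfolding nonneg_alternating_tails_def by blast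
qed

lemma nonneg_alternating_tails_mult_neg:
  assumes f: "nonneg_alternating_tails f A G L" and v: "fps_nonneg v"
  shows "nonneg_alternating_tails (\<lambda>j. f j + v * (f j + f (j + 1)))
    (\<lambda>k. A k + v * f k)
    (\<lambda>k. G k + v * (of_int (k - 1) * f k + A k)) (L + v)"
proof -
  have *: "\<And>j. fps_nonneg (f j)" "\<And>k. A k + A (k + 1) = f k"
    "\<And>k. G k + G (k + 1) = of_int k * f k"
    "\<And>k. k \<ge> 0 \<Longrightarrow> fps_nonneg (A k)" "\<And>k. k \<ge> 0 \<Longrightarrow> fps_nonneg (A (- k) - sgn_parity k)"
    "\<And>k. k \<ge> 1 \<Longrightarrow> fps_nonneg (G k)"
    "\<And>k. k \<ge> 1 \<Longrightarrow> fps_nonneg (sgn_parity k * L - G (- k))"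
    using f by (auto simp: nonneg_alternating_tails_def)
  have A': "A (k + 1) = f k - A k" for k using *(2)[of k] by (simp add: algebra_simps)
  have G': "G (k + 1) = of_int k * f k - G k" for k using *(3)[of k] by (simp add: algebra_simps)
  have "fps_nonneg (A (- k) + v * f (- k) - sgn_parity k)" if "k \<ge> 0" for k
  proof -
    have "fps_nonneg ((A (- k) - sgn_parity k) + v * f (- k))"
      using that by (intro fps_nonneg_add fps_nonneg_mult * v)
    then show ?thesis by (simp add: algebra_simps)
  qed
  moreover have "fps_nonneg (sgn_parity k * (L + v)
      - (G (- k) + v * (of_int (- k - 1) * f (- k) + A (- k))))" if "k \<ge> 1" for k
  proof -
    \<comment> \<open>Here the lower tail of \<open>f\<close> appears at index \<open>k - 1\<close>,
      which is nonnegative since \<open>k \<ge> 1\<close>; the sign flip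
      \<open>sgn_parity (k - 1) = - sgn_parity k\<close> matches the change of \<open>L\<close> by
      \<open>v\<close>.\<close>
    have "fps_nonneg ((sgn_parity k * L - G (- k))
        + v * (of_int k * f (- k) + (A (- (k - 1)) - sgn_parity (k - 1))))"
      using that by (intro fps_nonneg_add fps_nonneg_mult fps_nonneg_of_int * v) auto
    also have "A (- (k - 1)) = f (- k) - A (- k)" using A'[of "- k"] by (simp add: algebra_simps)
    finally show ?thesis by (simp add: algebra_simps)
  qed
  moreover have "fps_nonneg (G k + v * (of_int (k - 1) * f k + A k))" if "k \<ge> 1" for k
    using that by (intro fps_nonneg_add fps_nonneg_mult fps_nonneg_of_int * v) auto
  moreover have "fps_nonneg (f j + v * (f j + f (j + 1)))" for j
    by (intro fps_nonneg_add fps_nonneg_mult * v)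
  moreover have "fps_nonneg (A k + v * f k)" if "k \<ge> 0" for k
    using that by (intro fps_nonneg_add fps_nonneg_mult * v)
  moreover have "A k + v * f k + (A (k + 1) + v * f (k + 1)) = f k + v * (f k + f (k + 1))" for k
    unfolding A' by (simp add: algebra_simps)
  moreover have "G k + v * (of_int (k - 1) * f k + A k)
      + (G (k + 1) + v * (of_int (k + 1 - 1) * f (k + 1) + A (k + 1)))
      = of_int k * (f k + v * (f k + f (k + 1)))" for k
    unfolding A' G' by (simp add: algebra_simps)
  ultimately show ?thesis unfolding nonneg_alternating_tails_def by blast
qed

text \<open>By the recurrence for \<open>G\<close> the sum telescopes to
  \<open>sgn_parity k * (G (- k) - G k)\<close>, so the signed error is
  \<open>G k + (sgn_parity k * L - G (- k))\<close>, a sum of two nonnegative tails.\<close>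

lemma nonneg_alternating_tails_truncation:
  assumes f: "nonneg_alternating_tails f A G L" and k: "1 \<le> k"
  shows "fps_nonneg ((-1) ^ (k - 1) *
    ((\<Sum>j = - int k..int k - 1. sgn_parity j * of_int j * f j) - L))"
proof -
  have *: "\<And>k. G k + G (k + 1) = of_int k * f k" "\<And>k. k \<ge> 1 \<Longrightarrow> fps_nonneg (G k)"
    "\<And>k. k \<ge> 1 \<Longrightarrow> fps_nonneg (sgn_parity k * L - G (- k))"
    using f by (auto simp: nonneg_alternating_tails_def)
  have step: "sgn_parity j * of_int j * f j = sgn_parity j * G j - sgn_parity (j + 1) * G (j + 1)" for j
    by (simp only: sgn_parity_shift mult.assoc minus_mult_left[symmetric] diff_minus_eq_add
        distrib_left[symmetric] *(1))
  have tel: "(\<Sum>j = - int m..int m - 1. sgn_parity j * of_int j * f j)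
      = sgn_parity (int m) * (G (- int m) - G (int m))" for m
  proof (induction m)
    case (Suc m)
    define a where "a = - int m - 1"
    have a: "- int (Suc m) = a" "int (Suc m) = int m + 1" "a + 1 = - int m"
      "sgn_parity a = (- sgn_parity (int m) :: real fps)"
      unfolding a_def by simp_all
    have "{- int (Suc m)..int (Suc m) - 1} = insert a (insert (int m) {- int m..int m - 1})"
      by (auto simp: a_def)
    moreover have "a \<notin> insert (int m) {- int m..int m - 1}" by (auto simp: a_def)
    ultimately have "(\<Sum>j = - int (Suc m)..int (Suc m) - 1. sgn_parity j * of_int j * f j)
      = sgn_parity a * of_int a * f a + (sgn_parity (int m) * of_int (int m) * f (int m)
        + (\<Sum>j = - int m..int m - 1. sgn_parity j * of_int j * f j))"
      by (subst sum.insert | simp del: of_int_of_nat_eq)+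
    also have "\<dots> = sgn_parity (int (Suc m)) * (G (- int (Suc m)) - G (int (Suc m)))"
      unfolding a(1) Suc unfolding a(2) step[of "int m"] step[of a] unfolding a(3,4)
      by (simp add: algebra_simps)
    finally show ?case .
  qed simp
  have sg: "(-1) ^ (k - 1) = - (sgn_parity (int k) :: real fps)"
    using k by (cases k) (auto simp: sgn_parity_def uminus_power_if)
  have sq: "sgn_parity (int k) * sgn_parity (int k) = (1 :: real fps)"
    by (simp add: sgn_parity_def)
  have "fps_nonneg (G (int k) + (sgn_parity (int k) * L - G (- int k)))"
    using k by (intro fps_nonneg_add *) auto
  also have "G (int k) + (sgn_parity (int k) * L - G (- int k))
      = - sgn_parity (int k) * (sgn_parity (int k) * (G (- int k) - G (int k)) - L)"
    using sq by algebra
  finally show ?thesis unfolding tel sg .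
qed

section \<open>Limits of power series, coefficient by coefficient\<close>

lemma tendsto_fps_mult:
  fixes f g :: "'b \<Rightarrow> real fps"
  assumes "(f \<longlongrightarrow> a) F" "(g \<longlongrightarrow> b) F"
  shows "((\<lambda>x. f x * g x) \<longlongrightarrow> a * b) F"
proof (rule tendsto_fpsI)
  fix n
  have "eventually (\<lambda>x. \<forall>i\<in>{..n}. fps_nth (f x) i = fps_nth a i) F"
    "eventually (\<lambda>x. \<forall>i\<in>{..n}. fps_nth (g x) i = fps_nth b i) F"
    using assms by (auto simp: eventually_ball_finite_distrib tendsto_fps_iff)
  then show "eventually (\<lambda>x. fps_nth (f x * g x) n = fps_nth (a * b) n) F"
    by eventually_elim (auto simp: fps_mult_nth intro!: sum.cong)
qed

lemma tendsto_fps_diff: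
  fixes f g :: "'b \<Rightarrow> real fps"
  assumes "(f \<longlongrightarrow> a) F" "(g \<longlongrightarrow> b) F"
  shows "((\<lambda>x. f x - g x) \<longlongrightarrow> a - b) F"
proof (rule tendsto_fpsI)
  fix n
  show "eventually (\<lambda>x. fps_nth (f x - g x) n = fps_nth (a - b) n) F"
    using assms[unfolded tendsto_fps_iff, rule_format, of n] by eventually_elim simp
qed

lemma tendsto_fps_sum:
  fixes f :: "'a \<Rightarrow> 'b \<Rightarrow> real fps"
  assumes "\<And>i. i \<in> I \<Longrightarrow> (f i \<longlongrightarrow> a i) F" "finite I"
  shows "((\<lambda>x. \<Sum>i\<in>I. f i x) \<longlongrightarrow> (\<Sum>i\<in>I. a i)) F"
proof (rule tendsto_fpsI)
  fix n
  have "eventually (\<lambda>x. \<forall>i\<in>I. fps_nth (f i x) n = fps_nth (a i) n) F"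
    using assms by (auto simp: eventually_ball_finite_distrib tendsto_fps_iff)
  then show "eventually (\<lambda>x. fps_nth (\<Sum>i\<in>I. f i x) n = fps_nth (\<Sum>i\<in>I. a i) n) F"
    by eventually_elim (simp add: fps_sum_nth)
qed

lemma fps_nonneg_LIMSEQ:
  assumes "f \<longlonglongrightarrow> a" "\<And>N. fps_nonneg (f N)"
  shows "fps_nonneg a"
  unfolding fps_nonneg_def
proof
  fix n
  have "eventually (\<lambda>N. fps_nth (f N) n = fps_nth a n) sequentially"
    using assms(1) by (simp add: tendsto_fps_iff)
  then obtain N where "fps_nth (f N) n = fps_nth a n"
    by (auto simp: eventually_sequentially)
  with assms(2)[of N] show "0 \<le> fps_nth a n" unfolding fps_nonneg_def by metis
qed

section \<open>The finite Jacobi triple product\<close>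

text \<open>With \<open>Q = q^R\<close> this is the \<open>q\<close>-Pochhammer symbol
  \<open>(Q; Q)_n\<close>.\<close>

definition qfact :: "nat \<Rightarrow> nat \<Rightarrow> real fps" where
  "qfact R n = (\<Prod>i<n. 1 - fps_X ^ (R * Suc i))"

text \<open>
  The reciprocal of \<open>qfact\<close>, extended by zero to negative arguments: the \<open>q\<close>-binomial
  coefficient of the finite triple product then vanishes outside its range without case
  distinctions.
\<close>

definition inv_qfact :: "nat \<Rightarrow> int \<Rightarrow> real fps" where
  "inv_qfact R j = (if j < 0 then 0 else inverse (qfact R (nat j)))"

definition pair_prod :: "nat \<Rightarrow> nat \<Rightarrow> nat \<Rightarrow> real fps" where
  "pair_prod R S N = (\<Prod>i<N. (1 - fps_X ^ (i * R + S)) * (1 - fps_X ^ (i * R + R - S)))"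

text \<open>
  The coefficient of \<open>z^j\<close> in the normalised product of the first \<open>N\<close> pairs of factors, as
  given by the finite Jacobi triple product identity.
\<close>

definition triple_coeff :: "nat \<Rightarrow> nat \<Rightarrow> nat \<Rightarrow> int \<Rightarrow> real fps" where
  "triple_coeff R S N j = fps_X ^ theta_exponent R S j *
     (qfact R (2 * N) * inv_qfact R (int N + j) * inv_qfact R (int N - j)) * inverse (pair_prod R S N)"

lemma qfact_nth_0: "0 < R \<Longrightarrow> fps_nth (qfact R n) 0 = 1"
  by (induction n) (simp_all add: qfact_def)

text \<open>For \<open>j \<le> 0\<close> both sides vanish, because the factor becomes
  \<open>1 - fps_X ^ 0\<close>; hence the recurrence holds at all integers.\<close>

lemma inv_qfact_pred:
  assumes "0 < R" "i + 1 = j"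
  shows "inv_qfact R i = (1 - fps_X ^ (R * nat j)) * inv_qfact R j"
proof (cases "i < 0")
  case False
  then obtain m where m: "i = int m" by (metis nonneg_int_cases linorder_not_less)
  have "(1 - fps_X ^ (R * Suc m)) * inverse (1 - fps_X ^ (R * Suc m)) = (1 :: real fps)"
    using assms by (intro inverse_mult_eq_1') auto
  moreover have "nat (int m + 1) = Suc m" by simp
  ultimately show ?thesis
    unfolding assms(2)[symmetric] m inv_qfact_def
    by (simp add: qfact_def fps_inverse_mult mult_ac del: mult_Suc_right)
qed (use assms in \<open>auto simp: inv_qfact_def\<close>)

text \<open>Exponent bookkeeping: multiplying the theta term at \<open>j - 1\<close> by the new
  power \<open>q^(N R + R - S)\<close> gives the theta term at \<open>j\<close> times a power of
  \<open>q^R\<close>.\<close>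

lemma theta_exponent_pred:
  assumes "S < R" "j \<le> int N + 1"
  shows "theta_exponent R S (j - 1) + (N * R + R - S) = theta_exponent R S j + R * nat (int N + 1 - j)"
proof -
  have "real (theta_exponent R S (j - 1) + (N * R + R - S)) = real (theta_exponent R S j + R * nat (int N + 1 - j))"
    using assms by (simp add: real_theta_exponent of_nat_diff field_simps)
  then show ?thesis by (simp only: of_nat_eq_iff)
qed

lemma theta_exponent_succ:
  assumes "S < R" "- int N - 1 \<le> j"
  shows "theta_exponent R S (j + 1) + (N * R + S) = theta_exponent R S j + R * nat (int N + 1 + j)"
proof -
  have "real (theta_exponent R S (j + 1) + (N * R + S)) = real (theta_exponent R S j + R * nat (int N + 1 + j))"
    using assms by (simp add: real_theta_exponent field_simps)
  then show ?thesis by (simp only: of_nat_eq_iff)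
qed

text \<open>With Laurent variable \<open>zeta\<close>, the right side is the coefficient of
  \<open>zeta^j\<close> after multiplication by \<open>(1 + y zeta) (1 + z / zeta)\<close>. This
  recurrence is the induction step of the finite triple product identity.\<close>

lemma triple_coeff_Suc:
  fixes N :: nat and j :: int
  assumes "1 \<le> S" "S < R"
  defines "y \<equiv> fps_X ^ (N * R + R - S)" and "z \<equiv> fps_X ^ (N * R + S)"
  shows "(1 - y) * (1 - z) * triple_coeff R S (Suc N) j =
    (1 + y * z) * triple_coeff R S N j + y * triple_coeff R S N (j - 1) + z * triple_coeff R S N (j + 1)"
proof (cases "\<bar>j\<bar> \<le> int N + 1")
  \<comment> \<open>Beyond this range every term contains an inverse \<open>q\<close>-factorial at a
    negative argument.\<close>
  case False
  then show ?thesis by (auto simp: triple_coeff_def inv_qfact_def)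
next
  case True
  have R: "0 < R" using assms by simp
  define P where "P = inverse (pair_prod R S N)"
  define T where "T = (fps_X ^ theta_exponent R S j :: real fps)"
  define q where "q = qfact R (2 * N)"
  define s where "s = (fps_X ^ (R * nat (int N + j)) :: real fps)"
  define s' where "s' = (fps_X ^ (R * nat (int N + 1 + j)) :: real fps)"
  define t where "t = (fps_X ^ (R * nat (int N - j)) :: real fps)"
  define t' where "t' = (fps_X ^ (R * nat (int N + 1 - j)) :: real fps)"
  define m where "m = (fps_X ^ (R * (2 * N + 1)) :: real fps)"
  define Q where "Q = (fps_X ^ R :: real fps)"
  \<comment> \<open>These are the inverse \<open>q\<close>-factorials of stage \<open>N + 1\<close>.
    Every term is \<open>T * q * W * P\<close> times a polynomial, which leaves the identity
    \<open>poly\<close>.\<close>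
  define W where "W = inv_qfact R (int N + 1 + j) * inv_qfact R (int N + 1 - j)"
  have yz: "y * z = m"
    using assms unfolding y_def z_def m_def power_add[symmetric]
    by (intro arg_cong[of _ _ "power _"]) (simp add: algebra_simps)
  have unit: "(1 - y) * (1 - z) * inverse ((1 - z) * (1 - y)) = 1"
  proof -
    have "(1 - z) * (1 - y) * inverse ((1 - z) * (1 - y)) = 1"
      using assms by (intro inverse_mult_eq_1') (auto simp: y_def z_def)
    then show ?thesis by (simp add: mult.commute)
  qed
  have q: "qfact R (2 * Suc N) = q * (1 - m) * (1 - Q * m)"
    by (simp add: qfact_def q_def m_def Q_def mult.assoc power_add[symmetric] algebra_simps)
  have "pair_prod R S (Suc N) = pair_prod R S N * ((1 - z) * (1 - y))"
    by (simp add: pair_prod_def y_def z_def)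
  then have "(1 - y) * (1 - z) * triple_coeff R S (Suc N) j
      = T * (q * (1 - m) * (1 - Q * m) * W) * P * ((1 - y) * (1 - z) * inverse ((1 - z) * (1 - y)))"
    unfolding triple_coeff_def q W_def T_def P_def
    by (simp add: fps_inverse_mult add_ac mult_ac)
  then have lhs: "(1 - y) * (1 - z) * triple_coeff R S (Suc N) j = T * q * W * P * ((1 - m) * (1 - Q * m))"
    unfolding unit by (simp add: algebra_simps)
  have i: "int N + j + 1 = int N + 1 + j" "int N - j + 1 = int N + 1 - j"
    "int N + j - 1 + 1 = int N + j" "int N - j - 1 + 1 = int N - j"
    "int N + (j - 1) = int N + j - 1" "int N - (j - 1) = int N + 1 - j"
    "int N + (j + 1) = int N + 1 + j" "int N - (j + 1) = int N - j - 1"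
    by simp_all
  have f0: "triple_coeff R S N j = T * q * W * P * ((1 - s') * (1 - t'))"
    by (simp only: triple_coeff_def W_def T_def P_def q_def s'_def t'_def mult_ac
        inv_qfact_pred[OF R i(1)] inv_qfact_pred[OF R i(2)])
  have "y * fps_X ^ theta_exponent R S (j - 1) = T * t'"
    using theta_exponent_pred[of S R j N] assms(2) True
    by (simp add: y_def T_def t'_def power_add[symmetric] add.commute)
  moreover have "inv_qfact R (int N + (j - 1)) * inv_qfact R (int N - (j - 1)) = W * ((1 - s) * (1 - s'))"
    by (simp only: W_def s_def s'_def mult_ac i(5,6) inv_qfact_pred[OF R i(3)] inv_qfact_pred[OF R i(1)])
  moreover have "y * triple_coeff R S N (j - 1) = (y * fps_X ^ theta_exponent R S (j - 1)) *
      (q * (inv_qfact R (int N + (j - 1)) * inv_qfact R (int N - (j - 1)))) * P"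
    by (simp only: triple_coeff_def P_def q_def mult_ac)
  ultimately have f1: "y * triple_coeff R S N (j - 1) = T * q * W * P * (t' * ((1 - s) * (1 - s')))"
    by (simp only: mult_ac)
  have "z * fps_X ^ theta_exponent R S (j + 1) = T * s'"
    using theta_exponent_succ[of S R N j] assms(2) True
    by (simp add: z_def T_def s'_def power_add[symmetric] add.commute)
  moreover have "inv_qfact R (int N + (j + 1)) * inv_qfact R (int N - (j + 1)) = W * ((1 - t) * (1 - t'))"
    by (simp only: W_def t_def t'_def mult_ac i(7,8) inv_qfact_pred[OF R i(4)] inv_qfact_pred[OF R i(2)])
  moreover have "z * triple_coeff R S N (j + 1) = (z * fps_X ^ theta_exponent R S (j + 1)) *
      (q * (inv_qfact R (int N + (j + 1)) * inv_qfact R (int N - (j + 1)))) * P"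
    by (simp only: triple_coeff_def P_def q_def mult_ac)
  ultimately have f2: "z * triple_coeff R S N (j + 1) = T * q * W * P * (s' * ((1 - t) * (1 - t')))"
    by (simp only: mult_ac)
  have poly: "(1 - m) * (1 - Q * m) = (1 + m) * ((1 - s') * (1 - t'))
      + t' * ((1 - s) * (1 - s')) + s' * ((1 - t) * (1 - t'))"
  proof -
    \<comment> \<open>At the two extreme indices \<open>nat\<close> truncates -1 to 0, so
      \<open>s' = Q * s\<close> or \<open>t' = Q * t\<close> fails; there \<open>1 - s'\<close> or
      \<open>1 - t'\<close> is zero and removes the affected term.\<close>
    consider "j = - int N - 1" | "j = int N + 1" | "\<bar>j\<bar> \<le> int N" using True by linarith
    then show ?thesis
    proof cases
      case 1
      then have "nat (int N - j) = 2 * N + 1" "nat (int N + 1 - j) = 2 * N + 2" by linarith+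
      with 1 have "s' = 1" "t = m" "t' = Q * m"
        by (simp_all add: s'_def t_def t'_def m_def Q_def power_add[symmetric] nat_add_distrib algebra_simps)
      then show ?thesis by (simp add: algebra_simps)
    next
      case 2
      then have "nat (int N + j) = 2 * N + 1" "nat (int N + 1 + j) = 2 * N + 2" by linarith+
      with 2 have "t' = 1" "s = m" "s' = Q * m"
        by (simp_all add: s'_def s_def t'_def m_def Q_def power_add[symmetric] nat_add_distrib algebra_simps)
      then show ?thesis by (simp add: algebra_simps)
    next
      case 3
      have n: "nat (int N + 1 + j) = Suc (nat (int N + j))" "nat (int N + 1 - j) = Suc (nat (int N - j))"
        "2 * N + 1 = Suc (nat (int N + j) + nat (int N - j))"
        using 3 by linarith+
      have "s' = Q * s" "t' = Q * t" "m = Q * s * t"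
        unfolding s'_def s_def t'_def t_def m_def Q_def n power_add[symmetric]
        by (simp_all add: algebra_simps)
      then show ?thesis by (simp add: algebra_simps)
    qed
  qed
  show ?thesis unfolding lhs f0 f1 f2 yz poly by (simp add: algebra_simps)
qed

text \<open>Dividing the new factors \<open>1 + y zeta\<close> and \<open>1 + z / zeta\<close> by
  \<open>1 - y\<close> and \<open>1 - z\<close> gives \<open>1 + u (1 + zeta)\<close> and
  \<open>1 + v (1 + 1 / zeta)\<close>, so each stage applies both multiplication lemmas and adds
  \<open>v - u\<close> to the Lambert sum.\<close>

lemma nonneg_alternating_tails_triple_coeff:
  assumes "1 \<le> S" "S < R"
  shows "\<exists>A G. nonneg_alternating_tails (triple_coeff R S N) A G
    (\<Sum>m<N. fps_X ^ (m * R + S) / (1 - fps_X ^ (m * R + S))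
      - fps_X ^ (m * R + R - S) / (1 - fps_X ^ (m * R + R - S)))"
proof (induction N)
  case 0
  have "triple_coeff R S 0 = (\<lambda>j. of_bool (j = 0))"
    by (auto simp: triple_coeff_def inv_qfact_def pair_prod_def qfact_def theta_exponent_def)
  then show ?case using nonneg_alternating_tails_base by auto
next
  case (Suc N)
  define y where "y = (fps_X ^ (N * R + R - S) :: real fps)"
  define z where "z = (fps_X ^ (N * R + S) :: real fps)"
  define u where "u = y * inverse (1 - y)"
  define v where "v = z * inverse (1 - z)"
  define f where "f = triple_coeff R S N"
  have uv: "fps_nonneg u" "fps_nonneg v"
    unfolding u_def v_def y_def z_def using assms by (auto intro!: fps_nonneg_geometric)
  have yz: "(1 - y) * inverse (1 - y) = 1" "(1 - z) * inverse (1 - z) = 1"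
    using assms by (auto intro!: inverse_mult_eq_1' simp: y_def z_def)
  have div: "z / (1 - z) = v" "y / (1 - y) = u"
    unfolding u_def v_def using assms by (auto intro!: fps_divide_unit simp: y_def z_def)
  have step: "triple_coeff R S (Suc N) = (\<lambda>j. (f j + u * (f j + f (j - 1)))
      + v * ((f j + u * (f j + f (j - 1))) + (f (j + 1) + u * (f (j + 1) + f (j + 1 - 1)))))"
    (is "_ = ?g")
  proof
    fix j
    have u: "(1 - y) * u = y" and v: "(1 - z) * v = z"
      using yz unfolding u_def v_def by algebra+
    have "(1 - y) * (1 - z) * ?g j = (1 + y * z) * f j + y * f (j - 1) + z * f (j + 1)"
    proof -
      define h where "h = (\<lambda>i. f i + u * (f i + f (i - 1)))"
      have h: "(1 - y) * h i = f i + y * f (i - 1)" for i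
      proof -
        have "(1 - y) * h i = (1 - y) * f i + ((1 - y) * u) * (f i + f (i - 1))"
          by (simp only: h_def distrib_left mult.assoc)
        also have "\<dots> = f i + y * f (i - 1)" unfolding u by (simp add: algebra_simps)
        finally show ?thesis .
      qed
      have "(1 - y) * (1 - z) * ?g j = (1 - y) * (1 - z) * (h j + v * (h j + h (j + 1)))"
        by (simp only: h_def)
      also have "\<dots> = (1 - z) * ((1 - y) * h j) + ((1 - z) * v) * ((1 - y) * h j + (1 - y) * h (j + 1))"
        by (simp only: distrib_left mult_ac)
      finally show ?thesis unfolding v h by (simp add: algebra_simps)
    qed
    also have "\<dots> = (1 - y) * (1 - z) * triple_coeff R S (Suc N) j"
      unfolding triple_coeff_Suc[OF assms, of N j, folded y_def z_def] f_def ..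
    finally have "(1 - y) * (1 - z) * ?g j = (1 - y) * (1 - z) * triple_coeff R S (Suc N) j" .
    moreover have "(1 - y) * (1 - z) \<noteq> 0" using yz by auto
    ultimately show "triple_coeff R S (Suc N) j = ?g j" by (metis mult_left_cancel)
  qed
  obtain A G L where "nonneg_alternating_tails f A G L"
    and L: "L = (\<Sum>m<N. fps_X ^ (m * R + S) / (1 - fps_X ^ (m * R + S))
      - fps_X ^ (m * R + R - S) / (1 - fps_X ^ (m * R + R - S)))"
    using Suc unfolding f_def by blast
  note nonneg_alternating_tails_mult_neg[OF nonneg_alternating_tails_mult_pos[OF this(1) uv(1)] uv(2)]
  moreover have "(\<Sum>m<Suc N. fps_X ^ (m * R + S) / (1 - fps_X ^ (m * R + S))
      - fps_X ^ (m * R + R - S) / (1 - fps_X ^ (m * R + R - S))) = L - u + v"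
    using div by (simp add: L y_def z_def)
  ultimately show ?case unfolding step by auto
qed

section \<open>Passage to the infinite product\<close>

lemma qfact_LIMSEQ:
  assumes "0 < R"
  obtains p where "qfact R \<longlonglongrightarrow> p" "fps_nth p 0 = 1"
proof -
  have "fps_X ^ i dvd qfact R (Suc i) - qfact R i" for i
  proof -
    have "i \<le> R * Suc i" using assms mult_le_mono1[of 1 R "Suc i"] by simp
    moreover have "qfact R (Suc i) - qfact R i = - qfact R i * fps_X ^ (R * Suc i)"
      by (simp add: qfact_def algebra_simps)
    ultimately show ?thesis by (metis dvd_mult le_imp_power_dvd)
  qed
  then obtain p where "qfact R \<longlonglongrightarrow> p" "fps_nth p 0 = fps_nth (qfact R (Suc 0)) 0"
    using fps_partial_sums_LIMSEQ[of "qfact R"] by blast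
  then show ?thesis using that qfact_nth_0[OF assms] by metis
qed

text \<open>If \<open>p\<close> is the limit of \<open>qfact R\<close>, the
  \<open>q\<close>-binomial part tends to \<open>1 / p\<close>, while the inverse of
  \<open>pair_prod\<close> tends to \<open>p / P\<close> since the pairs lack the factors of
  \<open>(Q; Q)\<close>; the two powers of \<open>p\<close> cancel.\<close>

lemma triple_coeff_LIMSEQ:
  assumes "1 \<le> S" "S < R"
  shows "(\<lambda>N. triple_coeff R S N j) \<longlonglongrightarrow>
    fps_X ^ theta_exponent R S j / qpoch_inf [fps_X ^ S, fps_X ^ (R - S), fps_X ^ R] (fps_X ^ R)"
proof -
  have R: "0 < R" using assms by simp
  define P where "P = (qpoch_inf [fps_X ^ S, fps_X ^ (R - S), fps_X ^ R] (fps_X ^ R) :: real fps)"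
  define h where "h = (\<lambda>i. \<Prod>x\<leftarrow>[fps_X ^ S, fps_X ^ (R - S), fps_X ^ R]. (1 - x * (fps_X ^ R) ^ i :: real fps))"
  have P: "h has_prod P" "fps_nth P 0 = 1"
    using has_prod_qpoch_inf[OF assms] unfolding P_def h_def by auto
  then have "P \<noteq> 0" by auto
  with P(1) have "(\<lambda>n. \<Prod>i\<le>n. h i) \<longlonglongrightarrow> P" by (auto simp: has_prod_def raw_has_prod_def)
  then have lim_h: "(\<lambda>n. \<Prod>i<n. h i) \<longlonglongrightarrow> P" by (simp add: LIMSEQ_lessThan_iff_atMost)
  obtain p where p: "qfact R \<longlonglongrightarrow> p" "fps_nth p 0 = 1" using qfact_LIMSEQ[OF R] .
  have pp: "p * inverse p = 1" using p(2) by (intro inverse_mult_eq_1') auto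
  have h: "h i = (1 - fps_X ^ (i * R + S)) * (1 - fps_X ^ (i * R + R - S)) * (1 - fps_X ^ (R * Suc i))" for i
  proof -
    have "i * R + R - S = (R - S) + R * i" using assms by (simp add: algebra_simps)
    then show ?thesis
      by (simp add: h_def power_add[symmetric] power_mult[symmetric] algebra_simps)
  qed
  have prod_h: "(\<Prod>i<n. h i) = pair_prod R S n * qfact R n" for n
    by (simp add: h pair_prod_def qfact_def prod.distrib)
  have "inverse (pair_prod R S n) = qfact R n * inverse (\<Prod>i<n. h i)" for n
  proof -
    have "qfact R n * inverse (qfact R n) = 1"
      using qfact_nth_0[OF R, of n] by (intro inverse_mult_eq_1') auto
    then show ?thesis unfolding prod_h fps_inverse_mult by algebra
  qed
  moreover have "(\<lambda>n. qfact R n * inverse (\<Prod>i<n. h i)) \<longlonglongrightarrow> p * inverse P"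
    by (intro tendsto_fps_mult p(1) tendsto_inverse_fps lim_h) (use P in auto)
  ultimately have lim_pair: "(\<lambda>n. inverse (pair_prod R S n)) \<longlonglongrightarrow> p * inverse P" by simp
  have lim_inv: "(\<lambda>N. inv_qfact R (int N + i)) \<longlonglongrightarrow> inverse p" for i
  proof -
    have "filterlim (\<lambda>N. nat (int N + i)) at_top sequentially"
      unfolding filterlim_at_top eventually_sequentially
    proof (intro allI)
      fix Z
      show "\<exists>N. \<forall>n\<ge>N. Z \<le> nat (int n + i)" by (intro exI[of _ "Z + nat \<bar>i\<bar>"]) auto
    qed
    then have "(\<lambda>N. inverse (qfact R (nat (int N + i)))) \<longlonglongrightarrow> inverse p"
      by (intro tendsto_inverse_fps filterlim_compose[OF p(1)]) (use p in auto)
    moreover have "eventually (\<lambda>N. inverse (qfact R (nat (int N + i))) = inv_qfact R (int N + i)) sequentially"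
      using eventually_ge_at_top[of "nat \<bar>i\<bar>"] by eventually_elim (auto simp: inv_qfact_def)
    ultimately show ?thesis by (rule Lim_transform_eventually)
  qed
  have lim_double: "(\<lambda>N. qfact R (2 * N)) \<longlonglongrightarrow> p"
    by (rule filterlim_compose[OF p(1)]) (auto intro!: filterlim_subseq strict_monoI)
  have "(\<lambda>N. triple_coeff R S N j) \<longlonglongrightarrow>
      fps_X ^ theta_exponent R S j * (p * inverse p * inverse p) * (p * inverse P)"
    unfolding triple_coeff_def using lim_inv[of "- j"]
    by (intro tendsto_fps_mult tendsto_const lim_double lim_inv lim_pair) simp
  also have "fps_X ^ theta_exponent R S j * (p * inverse p * inverse p) * (p * inverse P)
      = fps_X ^ theta_exponent R S j / P"
  proof -
    have "fps_nth P 0 \<noteq> 0" using P(2) by simp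
    moreover have "a * (p * inverse p * inverse p) * (p * inverse P) = a * inverse P" for a
      using pp by algebra
    ultimately show ?thesis by (simp only: fps_divide_unit not_False_eq_True)
  qed
  finally show ?thesis unfolding P_def .
qed

theorem theorem3:
  fixes k R S n :: nat
  assumes "1 \<le> k" and "1 \<le> S" and "S < R" and "1 \<le> n"
  shows "0 \<le> fps_nth
    ((-1) ^ (k - 1) *
      ((\<Sum>j = - int k..int k - 1.
           fps_const ((-1) powi j * of_int j) * fps_X ^ theta_exponent R S j)
         / qpoch_inf [fps_X ^ S, fps_X ^ (R - S), fps_X ^ R] (fps_X ^ R)
       - (\<Sum>m. fps_X ^ (m * R + S) / (1 - fps_X ^ (m * R + S))
              - fps_X ^ (m * R + R - S) / (1 - fps_X ^ (m * R + R - S))))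
     :: real fps) n"
proof -
  define P where "P = (qpoch_inf [fps_X ^ S, fps_X ^ (R - S), fps_X ^ R] (fps_X ^ R) :: real fps)"
  define g where "g = (\<lambda>m. fps_X ^ (m * R + S) / (1 - fps_X ^ (m * R + S))
    - fps_X ^ (m * R + R - S) / (1 - fps_X ^ (m * R + R - S)) :: real fps)"
  \<comment> \<open>The error at stage \<open>N\<close>, with finite triple product coefficients and
    a partial Lambert sum; it is nonnegative for every \<open>N\<close>.\<close>
  define E where "E = (\<lambda>N. (-1) ^ (k - 1) *
    ((\<Sum>j = - int k..int k - 1. sgn_parity j * of_int j * triple_coeff R S N j) - (\<Sum>m<N. g m)))"
  have "fps_nonneg (E N)" for N
    using nonneg_alternating_tails_triple_coeff[OF assms(2,3), of N]
      nonneg_alternating_tails_truncation[OF _ assms(1)]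
    unfolding E_def g_def by blast
  moreover have "E \<longlonglongrightarrow> (-1) ^ (k - 1) *
    ((\<Sum>j = - int k..int k - 1. sgn_parity j * of_int j * (fps_X ^ theta_exponent R S j / P)) - (\<Sum>m. g m))"
    unfolding E_def P_def
    using summable_LIMSEQ[OF summable_lambert[OF assms(2,3)]]
    by (intro tendsto_fps_mult tendsto_fps_diff tendsto_fps_sum tendsto_const triple_coeff_LIMSEQ assms)
      (simp_all add: g_def)
  ultimately have "fps_nonneg ((-1) ^ (k - 1) *
    ((\<Sum>j = - int k..int k - 1. sgn_parity j * of_int j * (fps_X ^ theta_exponent R S j / P)) - (\<Sum>m. g m)))"
    by (rule fps_nonneg_LIMSEQ[rotated])
  moreover have "(\<Sum>j = - int k..int k - 1. sgn_parity j * of_int j * (fps_X ^ theta_exponent R S j / P))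
    = (\<Sum>j = - int k..int k - 1. fps_const ((-1) powi j * of_int j) * fps_X ^ theta_exponent R S j) / P"
  proof -
    have "fps_const ((-1) powi j * of_int j) = (sgn_parity j * of_int j :: real fps)" for j
    proof -
      have "(-1) powi j = (sgn_parity j :: real)"
        by (simp add: sgn_parity_def power_int_minus_one_minus)
      then show ?thesis by (auto simp: sgn_parity_def fps_of_int[symmetric] simp flip: fps_const_neg)
    qed
    \<comment> \<open>A nonzero constant term makes division by \<open>P\<close> multiplication by
      its inverse, which distributes over the sum.\<close>
    moreover have "fps_nth P 0 \<noteq> 0"
      using has_prod_qpoch_inf(2)[OF assms(2,3)] by (simp add: P_def)
    ultimately show ?thesis by (simp add: fps_divide_unit sum_distrib_right mult.assoc)
  qed
  ultimately show ?thesis unfolding fps_nonneg_def P_def g_def by simp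
qed

end
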